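(* Let $X$ be a quasiconvex doubling metric space, let $E\subset X$ be a nonempty compact porous set with $E\neq X$, and let $\mathcal{W}(X\setminus E)$ be any fixed Whitney cover of $X\setminus E$. Then $$\overline{\dim}_M(E)=\limsup_{k\to\infty}\tfrac1k\log_2\#\mathcal{W}_k(X\setminus E),\qquad \underline{\dim}_M(E)=\liminf_{k\to\infty}\tfrac1k\log_2\#\mathcal{W}_k(X\setminus E).$$
   Context: A metric space $(X,d)$ is doubling if there is $N\in\mathbb{N}$ such that every closed ball $B(x,r)=\{y: d(x,y)\le r\}$, $r>0$, can be covered by $N$ balls of radius $r/2$; $X$ is assumed to contain at least two points. Balls are closed and each ball comes with a fixed center and radius. Quasiconvex: there is $q\ge1$ such that for all $x,y\in X$ there is a curve $\gamma:[0,1]\to X$ with $\gamma(0)=x$, $\gamma(1)=y$ and $\operatorname{length}(\gamma)\le q\,d(x,y)$. Porous: $E\subset X$ is $\varrho$-porous if for every $x\in E$ and all $0<r<\operatorname{diam}(E)$ there is $y\in X$ with $B(y,\varrho r)\subset B(x,r)\setminus E$; $E$ is porous if it is $\varrho$-porous for some $0<\varrho\le1$. Minkowski dimensions: for compact $E$ and $\lambda\ge0$, $\mathcal{M}^\lambda_r(E)=\inf\{nr^\lambda: E\subset\bigcup_{k=1}^nB(x_k,r),\ x_k\in E\}$, $\overline{\dim}_M(E)=\inf\{\lambda\ge0:\limsup_{r\downarrow0}\mathcal{M}^\lambda_r(E)=0\}$, $\underline{\dim}_M(E)=\inf\{\lambda\ge0:\liminf_{r\downarrow0}\mathcal{M}^\lambda_r(E)=0\}$.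 Whitney cover: for an open set $\Omega\subsetneq X$, a Whitney cover $\mathcal{W}(\Omega)$ is a countable collection $\{B_i\}_{i\in I}$ of closed balls $B_i=B(x_i,r_i)$ with $x_i\in\Omega$, $r_i=\frac18\operatorname{dist}(x_i,X\setminus\Omega)$, $\Omega=\bigcup_iB_i$, and $\sum_i\chi_{B_i}\le C$ for some constant $C\ge1$. For $k\in\mathbb{Z}$, $\mathcal{W}_k(\Omega)=\{B(x_i,r_i)\in\mathcal{W}(\Omega):2^{-k-1}<r_i\le2^{-k}\}$. Convention: $\log_20=-\infty$. *)

theory Defs
  imports "HOL-Analysis.Analysis"
begin

text \<open>The ambient metric space \<open>X\<close> is the whole type \<open>'a :: metric_space\<close>; properties of \<open>X\<close> itself
  are predicates on \<open>'a itself\<close>.\<close>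

definition doubling_space :: "'a::metric_space itself \<Rightarrow> bool" where
  "doubling_space _ \<longleftrightarrow>
     (\<exists>N::nat. \<forall>(x::'a) r. r > 0 \<longrightarrow>
        (\<exists>c::nat \<Rightarrow> 'a. cball x r \<subseteq> (\<Union>k<N. cball (c k) (r / 2))))"

definition curve_length :: "(real \<Rightarrow> 'a::metric_space) \<Rightarrow> ereal" where
  "curve_length \<gamma> =
     Sup {ereal (\<Sum>i<n. dist (\<gamma> (t i)) (\<gamma> (t (Suc i)))) | (n::nat) (t::nat \<Rightarrow> real).
            t 0 = 0 \<and> t n = 1 \<and> (\<forall>i<n. t i \<le> t (Suc i))}"

definition quasiconvex_space :: "'a::metric_space itself \<Rightarrow> bool" where
  "quasiconvex_space _ \<longleftrightarrow>
     (\<exists>q\<ge>1::real. \<forall>(x::'a) y. \<exists>\<gamma>.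
        path \<gamma> \<and> pathstart \<gamma> = x \<and> pathfinish \<gamma> = y \<and> curve_length \<gamma> \<le> ereal (q * dist x y))"

text \<open>The library's real-valued \<open>diameter\<close> is meaningful only for bounded sets; for unbounded \<open>E\<close>
  (infinite diameter) every \<open>r > 0\<close> is admissible.\<close>

definition porous_with :: "real \<Rightarrow> 'a::metric_space set \<Rightarrow> bool" where
  "porous_with \<rho> E \<longleftrightarrow>
     (\<forall>x\<in>E. \<forall>r>0. (bounded E \<longrightarrow> r < diameter E) \<longrightarrow>
        (\<exists>y. cball y (\<rho> * r) \<subseteq> cball x r - E))"

definition porous :: "'a::metric_space set \<Rightarrow> bool" where
  "porous E \<longleftrightarrow> (\<exists>\<rho>. 0 < \<rho> \<and> \<rho> \<le> 1 \<and> porous_with \<rho> E)"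

definition minkowski_content :: "real \<Rightarrow> real \<Rightarrow> 'a::metric_space set \<Rightarrow> ereal" where
  "minkowski_content s r E =
     Inf {ereal (real n * r powr s) | n::nat.
            \<exists>x::nat \<Rightarrow> 'a. (\<forall>k\<in>{1..n}. x k \<in> E) \<and> E \<subseteq> (\<Union>k\<in>{1..n}. cball (x k) r)}"

definition upper_minkowski_dim :: "'a::metric_space set \<Rightarrow> ereal" where
  "upper_minkowski_dim E =
     Inf {ereal s | s. s \<ge> 0 \<and> Limsup (at_right 0) (\<lambda>r. minkowski_content s r E) = 0}"

definition lower_minkowski_dim :: "'a::metric_space set \<Rightarrow> ereal" where
  "lower_minkowski_dim E =
     Inf {ereal s | s. s \<ge> 0 \<and> Liminf (at_right 0) (\<lambda>r. minkowski_content s r E) = 0}"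

text \<open>Balls carry a fixed center and radius, so a collection of balls is a set of pairs
  \<open>(x, r)\<close> standing for \<open>cball x r\<close>. The last clause of \<open>whitney_cover\<close> is the pointwise bound
  on the sum of the characteristic functions; finiteness is needed since \<open>card\<close> of an infinite
  set is \<open>0\<close>.\<close>

definition whitney_cover :: "'a::metric_space set \<Rightarrow> ('a \<times> real) set \<Rightarrow> bool" where
  "whitney_cover \<Omega> W \<longleftrightarrow>
     open \<Omega> \<and> \<Omega> \<noteq> UNIV \<and> countable W \<and>
     (\<forall>(x, r)\<in>W. x \<in> \<Omega> \<and> r = infdist x (- \<Omega>) / 8) \<and>
     \<Omega> = (\<Union>(x, r)\<in>W. cball x r) \<and>
     (\<exists>C\<ge>1::real. \<forall>y. finite {(x, r)\<in>W. y \<in> cball x r} \<and>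
                       real (card {(x, r)\<in>W. y \<in> cball x r}) \<le> C)"

definition whitney_level :: "('a \<times> real) set \<Rightarrow> int \<Rightarrow> ('a \<times> real) set" where
  "whitney_level W k = {(x, r)\<in>W. 2 powi (- k - 1) < r \<and> r \<le> 2 powi (- k)}"

definition log2_card :: "'b set \<Rightarrow> ereal" where
  "log2_card A =
     (if infinite A then \<infinity> else if A = {} then - \<infinity> else ereal (log 2 (real (card A))))"

end

theory Submission
  imports Defs "HOL-Real_Asymp.Real_Asymp"
begin

text \<open>Let \<open>N(r)\<close> be the least number of \<open>r\<close>-balls centered in \<open>E\<close> that cover \<open>E\<close>. Then
  \<open>N(2\<^sup>-\<^sup>k)\<close> and the number of Whitney balls of level \<open>k\<close> agree up to a constant factor for large \<open>k\<close>.
  Level \<open>k\<close> balls have centers within \<open>8 \<cdot> 2\<^sup>-\<^sup>k\<close> of \<open>E\<close>, so doubling and bounded overlap bound their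
  number by a multiple of \<open>N(2\<^sup>-\<^sup>k)\<close>. Conversely, porosity gives near each point of \<open>E\<close> a point far
  enough from \<open>E\<close>; the distance to \<open>E\<close> takes the value \<open>5 \<cdot> 2\<^sup>-\<^sup>k\<close> along a quasiconvex curve joining
  them, which produces a level \<open>k\<close> ball nearby. Both dimensions are the upper and lower limits of
  \<open>log\<^sub>2 N(2\<^sup>-\<^sup>k) / k\<close>, and a constant factor disappears in the limit.\<close>

section \<open>Covering numbers\<close>

text \<open>Centers are taken in \<open>E\<close>, as in the Minkowski content. Without a finite
  cover of this kind the value is unspecified, so attainment is proved for compact \<open>E\<close>
  and \<open>r > 0\<close>.\<close>

definition covering_number :: "real \<Rightarrow> 'a::metric_space set \<Rightarrow> nat" where
  "covering_number r E =
     (LEAST n. \<exists>F. finite F \<and> F \<subseteq> E \<and> card F = n \<and> E \<subseteq> (\<Union>x\<in>F. cball x r))"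

lemma covering_number_le:
  assumes "finite F" "F \<subseteq> E" "E \<subseteq> (\<Union>x\<in>F. cball x r)"
  shows "covering_number r E \<le> card F"
  unfolding covering_number_def using assms by (intro Least_le) blast

lemma covering_number_attained:
  fixes E :: "'a::metric_space set"
  assumes "compact E" "r > 0"
  obtains F where "finite F" "F \<subseteq> E" "card F = covering_number r E" "E \<subseteq> (\<Union>x\<in>F. cball x r)"
proof -
  obtain F where F: "finite F" "F \<subseteq> E" "E \<subseteq> (\<Union>x\<in>F. ball x r)"
    using compact_imp_seq_compact[OF assms(1)] seq_compact_imp_totally_bounded assms(2) by metis
  have "E \<subseteq> (\<Union>x\<in>F. cball x r)"
    using F(3) ball_subset_cball by blast
  then have "\<exists>n F. finite F \<and> F \<subseteq> E \<and> card F = n \<and> E \<subseteq> (\<Union>x\<in>F. cball x r)"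
    using F by blast
  from LeastI_ex[OF this] show thesis
    using that unfolding covering_number_def by blast
qed

lemma covering_number_antimono:
  fixes E :: "'a::metric_space set"
  assumes "compact E" "0 < r" "r \<le> r'"
  shows "covering_number r' E \<le> covering_number r E"
proof -
  obtain F where F: "finite F" "F \<subseteq> E" "card F = covering_number r E" "E \<subseteq> (\<Union>x\<in>F. cball x r)"
    by (rule covering_number_attained[OF assms(1,2)])
  have "(\<Union>x\<in>F. cball x r) \<subseteq> (\<Union>x\<in>F. cball x r')"
    using assms(3) by (intro UN_mono subset_cball) auto
  with F(4) have "E \<subseteq> (\<Union>x\<in>F. cball x r')" by (rule order_trans)
  then show ?thesis using covering_number_le[OF F(1,2)] F(3) by simp
qed

lemma covering_number_ge_1:
  fixes E :: "'a::metric_space set"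
  assumes "compact E" "E \<noteq> {}" "r > 0"
  shows "1 \<le> covering_number r E"
proof -
  obtain F where F: "finite F" "F \<subseteq> E" "card F = covering_number r E" "E \<subseteq> (\<Union>x\<in>F. cball x r)"
    by (rule covering_number_attained[OF assms(1,3)])
  then have "F \<noteq> {}" using assms by auto
  then show ?thesis using F(1) by (simp add: F(3)[symmetric] Suc_le_eq card_gt_0_iff)
qed

text \<open>Moving the centers into \<open>E\<close> costs a factor 2 in the radius: balls missing
  \<open>E\<close> are discarded, and each remaining center is replaced by a point of
  \<open>E\<close> in its ball.\<close>

lemma covering_number_le_off_center:
  fixes E :: "'a::metric_space set"
  assumes "finite G" "E \<subseteq> (\<Union>z\<in>G. cball z r)"
  shows "covering_number (2 * r) E \<le> card G"
proof -
  define G' where "G' = {z \<in> G. cball z r \<inter> E \<noteq> {}}"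
  have "\<forall>z\<in>G'. \<exists>e. e \<in> cball z r \<inter> E" by (auto simp: G'_def)
  then obtain e where e: "\<And>z. z \<in> G' \<Longrightarrow> e z \<in> cball z r \<inter> E" by metis
  have fin: "finite G'" and sub: "G' \<subseteq> G" using assms(1) by (auto simp: G'_def)
  have "E \<subseteq> (\<Union>x\<in>e ` G'. cball x (2 * r))"
  proof
    fix x assume x: "x \<in> E"
    then obtain z where z: "z \<in> G" "x \<in> cball z r" using assms(2) by blast
    then have "z \<in> G'" using x by (auto simp: G'_def)
    moreover have "dist (e z) x \<le> 2 * r"
      using e[OF \<open>z \<in> G'\<close>] z(2) dist_triangle[of "e z" x z] by (auto simp: dist_commute)
    ultimately show "x \<in> (\<Union>x\<in>e ` G'. cball x (2 * r))" by auto
  qed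
  then have "covering_number (2 * r) E \<le> card (e ` G')"
    using fin e by (intro covering_number_le) auto
  also have "\<dots> \<le> card G'" using fin by (rule card_image_le)
  also have "\<dots> \<le> card G" using sub assms(1) by (rule card_mono[rotated])
  finally show ?thesis .
qed

text \<open>Repetitions in an indexed family of centers can only increase \<open>n\<close>, so the
  infimum is attained by enumerating a minimal set of centers.\<close>

lemma minkowski_content_eq:
  fixes E :: "'a::metric_space set"
  assumes "compact E" "r > 0"
  shows "minkowski_content s r E = ereal (real (covering_number r E) * r powr s)"
proof (rule antisym)
  obtain F where F: "finite F" "F \<subseteq> E" "card F = covering_number r E" "E \<subseteq> (\<Union>x\<in>F. cball x r)"
    by (rule covering_number_attained[OF assms])
  obtain h where h: "bij_betw h {1..card F} F"
    using ex_bij_betw_nat_finite_1[OF F(1)] by blast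
  have img: "h ` {1..card F} = F" using h by (auto simp: bij_betw_def)
  have "E \<subseteq> (\<Union>k\<in>{1..card F}. cball (h k) r)"
  proof
    fix x assume "x \<in> E"
    then obtain y where "y \<in> F" "x \<in> cball y r" using F(4) by blast
    moreover from this(1) obtain k where "k \<in> {1..card F}" "y = h k" using img by blast
    ultimately show "x \<in> (\<Union>k\<in>{1..card F}. cball (h k) r)" by blast
  qed
  moreover have "\<forall>k\<in>{1..card F}. h k \<in> E" using img F(2) by blast
  ultimately show "minkowski_content s r E \<le> ereal (real (covering_number r E) * r powr s)"
    unfolding minkowski_content_def using F(3) by (intro Inf_lower) auto
next
  show "ereal (real (covering_number r E) * r powr s) \<le> minkowski_content s r E"
    unfolding minkowski_content_def
  proof (rule Inf_greatest, clarify)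
    fix n and x :: "nat \<Rightarrow> 'a"
    assume x: "\<forall>k\<in>{1..n}. x k \<in> E" "E \<subseteq> (\<Union>k\<in>{1..n}. cball (x k) r)"
    have "covering_number r E \<le> card (x ` {1..n})"
      using x by (intro covering_number_le) auto
    also have "\<dots> \<le> n" using card_image_le[of "{1..n}" x] by simp
    finally show "ereal (real (covering_number r E) * r powr s) \<le> ereal (real n * r powr s)"
      by (simp add: mult_right_mono)
  qed
qed

section \<open>Covers by iterated doubling\<close>

lemma doubling_cover:
  fixes x :: "'a::metric_space"
  assumes dbl: "\<And>(x::'a) r. r > 0 \<Longrightarrow> \<exists>c::nat \<Rightarrow> 'a. cball x r \<subseteq> (\<Union>k<N. cball (c k) (r / 2))"
    and "r > 0"
  shows "\<exists>F. finite F \<and> card F \<le> N ^ p \<and> cball x r \<subseteq> (\<Union>z\<in>F. cball z (r / 2 ^ p))"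
proof (induction p)
  case 0
  show ?case by (intro exI[of _ "{x}"]) auto
next
  case (Suc p)
  then obtain F where F: "finite F" "card F \<le> N ^ p" "cball x r \<subseteq> (\<Union>z\<in>F. cball z (r / 2 ^ p))"
    by blast
  have "\<forall>z. \<exists>c::nat \<Rightarrow> 'a. cball z (r / 2 ^ p) \<subseteq> (\<Union>k<N. cball (c k) (r / 2 ^ p / 2))"
    using dbl assms(2) by (intro allI) (rule dbl, simp)
  then obtain c :: "'a \<Rightarrow> nat \<Rightarrow> 'a" where
    c: "\<And>z. cball z (r / 2 ^ p) \<subseteq> (\<Union>k<N. cball (c z k) (r / 2 ^ p / 2))" by metis
  let ?G = "\<Union>z\<in>F. c z ` {..<N}"
  have "card ?G \<le> (\<Sum>z\<in>F. card (c z ` {..<N}))" using F(1) by (rule card_UN_le)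
  also have "\<dots> \<le> (\<Sum>z\<in>F. N)"
    by (intro sum_mono) (metis card_image_le card_lessThan finite_lessThan)
  also have "\<dots> \<le> N ^ Suc p" using F(2) by simp
  finally have "card ?G \<le> N ^ Suc p" .
  moreover have "cball x r \<subseteq> (\<Union>z\<in>?G. cball z (r / 2 ^ Suc p))"
  proof
    fix y assume "y \<in> cball x r"
    then obtain z where z: "z \<in> F" "y \<in> cball z (r / 2 ^ p)" using F(3) by blast
    then obtain k where "k < N" "y \<in> cball (c z k) (r / 2 ^ p / 2)" using c[of z] by blast
    then show "y \<in> (\<Union>z\<in>?G. cball z (r / 2 ^ Suc p))"
      using z(1) by (auto simp: mult.commute)
  qed
  ultimately show ?case using F(1) by (intro exI[of _ ?G]) auto
qed

lemma doubling_cover_union: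
  fixes F :: "'a::metric_space set"
  assumes dbl: "\<And>(x::'a) r. r > 0 \<Longrightarrow> \<exists>c::nat \<Rightarrow> 'a. cball x r \<subseteq> (\<Union>k<N. cball (c k) (r / 2))"
    and "r > 0" "finite F"
  obtains G where "finite G" "card G \<le> card F * N ^ p"
    "(\<Union>x\<in>F. cball x r) \<subseteq> (\<Union>z\<in>G. cball z (r / 2 ^ p))"
proof -
  have "\<forall>x. \<exists>H. finite H \<and> card H \<le> N ^ p \<and> cball (x::'a) r \<subseteq> (\<Union>z\<in>H. cball z (r / 2 ^ p))"
    using doubling_cover[OF dbl assms(2), where p = p] by blast
  then obtain H where H: "\<And>x::'a. finite (H x)" "\<And>x. card (H x) \<le> N ^ p"
    "\<And>x. cball x r \<subseteq> (\<Union>z\<in>H x. cball z (r / 2 ^ p))" by metis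
  let ?G = "\<Union>x\<in>F. H x"
  have "card ?G \<le> (\<Sum>x\<in>F. card (H x))" using assms(3) by (rule card_UN_le)
  also have "\<dots> \<le> card F * N ^ p" using sum_bounded_above[of F "\<lambda>x. card (H x)" "N ^ p"] H(2) by simp
  finally have "card ?G \<le> card F * N ^ p" .
  moreover have "(\<Union>x\<in>F. cball x r) \<subseteq> (\<Union>z\<in>?G. cball z (r / 2 ^ p))"
    using H(3) by blast
  ultimately show thesis using H(1) assms(3) by (intro that[of ?G]) auto
qed

text \<open>One halving beyond \<open>p\<close> is made because doubling puts the centers anywhere
  in the space: balls of radius \<open>r / 2\<close> are reached first, and recentering in
  \<open>E\<close> brings the radius back to \<open>r\<close>.\<close>

lemma covering_number_doubling:
  fixes E :: "'a::metric_space set"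
  assumes dbl: "\<And>(x::'a) r. r > 0 \<Longrightarrow> \<exists>c::nat \<Rightarrow> 'a. cball x r \<subseteq> (\<Union>k<N. cball (c k) (r / 2))"
    and "compact E" "r > 0"
  shows "covering_number r E \<le> covering_number (2 ^ p * r) E * N ^ Suc p"
proof -
  have r: "2 ^ p * r > 0" using assms by simp
  obtain F where F: "finite F" "card F = covering_number (2 ^ p * r) E"
    "E \<subseteq> (\<Union>x\<in>F. cball x (2 ^ p * r))"
    using covering_number_attained[OF assms(2) r] by metis
  obtain G where G: "finite G" "card G \<le> card F * N ^ Suc p"
    "(\<Union>x\<in>F. cball x (2 ^ p * r)) \<subseteq> (\<Union>z\<in>G. cball z (2 ^ p * r / 2 ^ Suc p))"
    using doubling_cover_union[of N "2 ^ p * r" F "Suc p", OF dbl r F(1)] by metis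
  have "covering_number (2 * (r / 2)) E \<le> card G"
    using F(3) G(1,3) by (intro covering_number_le_off_center) auto
  then show ?thesis using G(2) F(2) by simp
qed

section \<open>Dimensions from dyadic covering numbers\<close>

text \<open>Brackets \<open>r\<close> between consecutive powers of 1/2, so that monotonicity
  reduces small radii to dyadic ones. Since \<open>r \<le> 1\<close>, the logarithm is nonnegative
  and \<open>nat\<close> truncates nothing.\<close>

lemma dyadic_scale:
  assumes "0 < r" "r \<le> 1"
  shows "r \<le> (1/2) ^ nat \<lfloor>log 2 (1 / r)\<rfloor>" "(1/2) ^ Suc (nat \<lfloor>log 2 (1 / r)\<rfloor>) \<le> r"
proof -
  define k where "k = nat \<lfloor>log 2 (1 / r)\<rfloor>"
  have "0 \<le> log 2 (1 / r)" using assms by simp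
  then have k: "real k \<le> log 2 (1 / r)" "log 2 (1 / r) \<le> real (Suc k)"
    unfolding k_def by linarith+
  have r: "2 powr log 2 (1 / r) = 1 / r" using assms by simp
  have "2 powr real k \<le> 1 / r" using k(1) r by (metis powr_mono one_le_numeral)
  then show "r \<le> (1/2) ^ k"
    using assms by (simp add: powr_realpow power_divide field_simps)
  have "1 / r \<le> 2 powr real (Suc k)" using k(2) r by (metis powr_mono one_le_numeral)
  then show "(1/2) ^ Suc k \<le> r"
    using assms by (simp add: powr_realpow power_divide field_simps del: power_Suc of_nat_Suc)
qed

text \<open>Carries statements about all large \<open>k\<close> over to all small radii; the next
  limit goes the other way.\<close>

lemma filterlim_dyadic_scale: "filterlim (\<lambda>r::real. nat \<lfloor>log 2 (1 / r)\<rfloor>) at_top (at_right 0)"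
  by (intro filterlim_compose[OF filterlim_nat_sequentially]
        filterlim_compose[OF filterlim_floor_sequentially]) real_asymp

lemma filterlim_half_power: "filterlim (\<lambda>k::nat. (1/2::real) ^ k) (at_right 0) sequentially"
  by real_asymp

lemma dyadic_powr: "((1/2::real) ^ k) powr s = 2 powr (- (s * real k))"
proof -
  have "(1/2::real) ^ k = 2 powr (- real k)"
    by (simp add: powr_minus powr_realpow power_one_over inverse_eq_divide)
  then show ?thesis by (simp add: powr_powr mult.commute)
qed

lemma powr_neg_mult_tendsto_0:
  fixes a :: real
  assumes "a < 0"
  shows "(\<lambda>k. 2 powr (a * real k)) \<longlonglongrightarrow> 0"
proof -
  have "2 powr a < 1" using powr_less_cancel_iff[of 2 a 0] assms by simp
  then have "(\<lambda>k. (2 powr a) ^ k) \<longlonglongrightarrow> 0" by (intro LIMSEQ_power_zero) simp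
  then show ?thesis by (simp add: powr_realpow[symmetric] powr_powr)
qed

context
  fixes E :: "'a::metric_space set"
  assumes E: "compact E" "E \<noteq> {}"
begin

private definition dyadic_number :: "nat \<Rightarrow> real" where
  "dyadic_number k = real (covering_number ((1/2) ^ k) E)"

text \<open>The growth exponent of the covering number at scale \<open>(1/2) ^ k\<close>. Division
  by zero makes it 0 at \<open>k = 0\<close>, which is why several facts below assume
  \<open>0 < k\<close>.\<close>

private definition dyadic_exponent :: "nat \<Rightarrow> real" where
  "dyadic_exponent k = log 2 (dyadic_number k) / real k"

private lemma dyadic_number_ge_1: "1 \<le> dyadic_number k"
  unfolding dyadic_number_def using covering_number_ge_1[OF E, of "(1/2)^k"] by simp

private lemma dyadic_exponent_nonneg: "0 \<le> dyadic_exponent k"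
  unfolding dyadic_exponent_def using dyadic_number_ge_1[of k] by simp

private lemma dyadic_number_eq: "0 < k \<Longrightarrow> dyadic_number k = 2 powr (dyadic_exponent k * real k)"
  unfolding dyadic_exponent_def using dyadic_number_ge_1[of k] by simp

text \<open>Along dyadic radii, growth or decay of the content is governed by the sign of
  \<open>dyadic_exponent k - s\<close>.\<close>

private lemma content_dyadic:
  assumes "0 < k"
  shows "minkowski_content s ((1/2) ^ k) E = ereal (2 powr ((dyadic_exponent k - s) * real k))"
  using dyadic_number_eq[OF assms]
  by (simp add: minkowski_content_eq[OF E(1)] dyadic_powr powr_add[symmetric] left_diff_distrib
      dyadic_number_def)

private lemma content_nonneg: "r > 0 \<Longrightarrow> 0 \<le> minkowski_content s r E"
  by (simp add: minkowski_content_eq[OF E(1)])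

text \<open>The covering number is bounded at the smaller dyadic radius and the power of
  \<open>r\<close> at the larger one; this mismatch of one level costs the factor
  \<open>2 powr s\<close>.\<close>

private lemma content_le:
  assumes "0 < r" "r \<le> 1" "s \<ge> 0" "k = nat \<lfloor>log 2 (1 / r)\<rfloor>"
  shows "minkowski_content s r E \<le> ereal (2 powr s * 2 powr ((dyadic_exponent (Suc k) - s) * real (Suc k)))"
proof -
  have r: "r \<le> (1/2) ^ k" "(1/2) ^ Suc k \<le> r"
    using dyadic_scale[OF assms(1,2)] assms(4) by auto
  have "real (covering_number r E) \<le> dyadic_number (Suc k)"
    unfolding dyadic_number_def
    using covering_number_antimono[OF E(1) _ r(2)] by simp
  moreover have "r powr s \<le> 2 powr (- (s * real k))"
    using powr_mono2[OF assms(3) _ r(1)] assms(1) unfolding dyadic_powr by simp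
  ultimately have "real (covering_number r E) * r powr s \<le> dyadic_number (Suc k) * 2 powr (- (s * real k))"
    by (intro mult_mono) auto
  also have "\<dots> = 2 powr (dyadic_exponent (Suc k) * real (Suc k) - s * real k)"
    using dyadic_number_eq[of "Suc k"] by (simp add: powr_add[symmetric])
  also have "\<dots> = 2 powr s * 2 powr ((dyadic_exponent (Suc k) - s) * real (Suc k))"
    by (simp add: powr_add[symmetric] algebra_simps)
  finally show ?thesis using assms(1) by (simp add: minkowski_content_eq[OF E(1)])
qed

text \<open>The opposite choice of dyadic radii, with the factor \<open>2 powr (-s)\<close> as the
  loss.\<close>

private lemma content_ge:
  assumes "0 < r" "r \<le> 1" "s \<ge> 0" "k = nat \<lfloor>log 2 (1 / r)\<rfloor>" "0 < k"
  shows "ereal (2 powr (-s) * 2 powr ((dyadic_exponent k - s) * real k)) \<le> minkowski_content s r E"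
proof -
  have r: "r \<le> (1/2) ^ k" "(1/2) ^ Suc k \<le> r"
    using dyadic_scale[OF assms(1,2)] assms(4) by auto
  have "2 powr (-s) * 2 powr ((dyadic_exponent k - s) * real k)
      = 2 powr (dyadic_exponent k * real k) * 2 powr (- (s * real (Suc k)))"
    by (simp add: powr_add[symmetric] algebra_simps)
  also have "\<dots> = dyadic_number k * ((1/2) ^ Suc k) powr s"
    unfolding dyadic_powr dyadic_number_eq[OF assms(5)] ..
  also have "\<dots> \<le> real (covering_number r E) * r powr s"
  proof (intro mult_mono)
    show "dyadic_number k \<le> real (covering_number r E)"
      unfolding dyadic_number_def using covering_number_antimono[OF E(1) assms(1) r(1)] by simp
    show "((1/2) ^ Suc k) powr s \<le> r powr s"
      using r(2) assms(3) by (intro powr_mono2) auto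
  qed auto
  finally show ?thesis using assms(1) by (simp add: minkowski_content_eq[OF E(1)])
qed

private lemma eventually_small_radius: "\<forall>\<^sub>F r::real in at_right 0. 0 < r \<and> r \<le> 1"
  unfolding eventually_at_right_field by (intro exI[of _ 1]) auto

text \<open>For \<open>s\<close> above the upper limit the content decays geometrically in the
  level. Conversely, content below 1 at a dyadic radius already forces the exponent below
  \<open>s\<close>.\<close>

lemma upper_minkowski_dim_dyadic: "upper_minkowski_dim E = limsup (\<lambda>k. ereal (dyadic_exponent k))"
proof (rule antisym)
  let ?L = "limsup (\<lambda>k. ereal (dyadic_exponent k))"
  have L: "0 \<le> ?L"
    using dyadic_exponent_nonneg by (intro le_Limsup) auto
  show "upper_minkowski_dim E \<le> ?L"
  proof (rule dense_ge)
    fix x assume "?L < x"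
    from ereal_dense2[OF this] obtain s where s: "?L < ereal s" "ereal s < x" by blast
    \<comment> \<open>The intermediate \<open>t\<close> gives a fixed negative rate
      \<open>t - s\<close>, whereas exponents merely below \<open>s\<close> might approach
      \<open>s\<close>.\<close>
    from ereal_dense2[OF s(1)] obtain t where t: "?L < ereal t" "ereal t < ereal s" by blast
    have "0 < ereal s" using L s(1) by (rule le_less_trans)
    then have s0: "s \<ge> 0" by simp
    have "\<forall>\<^sub>F k in sequentially. ereal (dyadic_exponent k) < ereal t" using Limsup_lessD[OF t(1)] .
    \<comment> \<open>The index is shifted because \<open>content_le\<close> evaluates the exponent
      at \<open>Suc k\<close>.\<close>
    then have "\<forall>\<^sub>F k in sequentially. dyadic_exponent (Suc k) < t"
      using eventually_sequentially_Suc[of "\<lambda>k. dyadic_exponent k < t"] by simp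
    then have ev: "\<forall>\<^sub>F r in at_right 0. dyadic_exponent (Suc (nat \<lfloor>log 2 (1 / r)\<rfloor>)) < t"
      by (rule eventually_compose_filterlim[OF _ filterlim_dyadic_scale])
    have "((\<lambda>r. minkowski_content s r E) \<longlongrightarrow> 0) (at_right 0)"
    proof (rule tendsto_sandwich)
      show "\<forall>\<^sub>F r in at_right 0. 0 \<le> minkowski_content s r E"
        using eventually_small_radius by eventually_elim (simp add: content_nonneg)
      show "\<forall>\<^sub>F r in at_right 0. minkowski_content s r E
          \<le> ereal (2 powr s * 2 powr ((t - s) * real (Suc (nat \<lfloor>log 2 (1 / r)\<rfloor>))))"
        using ev eventually_small_radius
      proof eventually_elim
        case (elim r)
        let ?k = "Suc (nat \<lfloor>log 2 (1 / r)\<rfloor>)"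
        have "minkowski_content s r E \<le> ereal (2 powr s * 2 powr ((dyadic_exponent ?k - s) * real ?k))"
          using elim s0 by (intro content_le) auto
        also have "2 powr s * 2 powr ((dyadic_exponent ?k - s) * real ?k)
            \<le> 2 powr s * 2 powr ((t - s) * real ?k)"
          using elim(1) by (intro mult_left_mono powr_mono mult_right_mono) auto
        finally show ?case by simp
      qed
      have "t - s < 0" using t by simp
      then have "((\<lambda>k. 2 powr s * 2 powr ((t - s) * real (Suc k))) \<longlongrightarrow> 0) sequentially"
        by (intro tendsto_mult_right_zero LIMSEQ_Suc[OF powr_neg_mult_tendsto_0])
      then have "((\<lambda>r. 2 powr s * 2 powr ((t - s) * real (Suc (nat \<lfloor>log 2 (1 / r)\<rfloor>)))) \<longlongrightarrow> 0) (at_right 0)"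
        by (rule filterlim_compose[OF _ filterlim_dyadic_scale])
      then show "((\<lambda>r. ereal (2 powr s * 2 powr ((t - s) * real (Suc (nat \<lfloor>log 2 (1 / r)\<rfloor>))))) \<longlongrightarrow> 0) (at_right 0)"
        unfolding zero_ereal_def by (rule tendsto_ereal)
    qed auto
    then have "Limsup (at_right 0) (\<lambda>r. minkowski_content s r E) = 0"
      by (intro lim_imp_Limsup) auto
    then have "upper_minkowski_dim E \<le> ereal s"
      unfolding upper_minkowski_dim_def using s0 by (intro Inf_lower) blast
    then show "upper_minkowski_dim E \<le> x" using s(2) by simp
  qed
  show "?L \<le> upper_minkowski_dim E"
    unfolding upper_minkowski_dim_def
  proof (rule Inf_greatest, clarify)
    fix s assume "Limsup (at_right 0) (\<lambda>r. minkowski_content s r E) = 0"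
    then have "\<forall>\<^sub>F r in at_right 0. minkowski_content s r E < 1"
      by (intro Limsup_lessD) simp
    then have "\<forall>\<^sub>F k in sequentially. minkowski_content s ((1/2) ^ k) E < 1"
      by (rule eventually_compose_filterlim[OF _ filterlim_half_power])
    then have "\<forall>\<^sub>F k in sequentially. ereal (dyadic_exponent k) \<le> ereal s"
      using eventually_gt_at_top[of 0]
    proof eventually_elim
      case (elim k)
      then have "2 powr ((dyadic_exponent k - s) * real k) < 2 powr 0"
        by (simp add: content_dyadic)
      then have "(dyadic_exponent k - s) * real k < 0" by (subst (asm) powr_less_cancel_iff) auto
      then show ?case using elim(2) by (simp add: mult_less_0_iff)
    qed
    then show "?L \<le> ereal s" by (rule Limsup_bounded)
  qed
qed

text \<open>Both halves are indirect. If the content had positive lower limit for some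
  \<open>s > ?L\<close>, the exponents would eventually be at least some \<open>t > ?L\<close>. If
  the exponents were eventually above \<open>s\<close>, the content would stay above
  \<open>2 powr (-s)\<close>.\<close>

lemma lower_minkowski_dim_dyadic: "lower_minkowski_dim E = liminf (\<lambda>k. ereal (dyadic_exponent k))"
proof (rule antisym)
  let ?L = "liminf (\<lambda>k. ereal (dyadic_exponent k))"
  have L: "0 \<le> ?L"
    using dyadic_exponent_nonneg by (intro Liminf_bounded) auto
  have nonneg: "0 \<le> Liminf (at_right 0) (\<lambda>r. minkowski_content s r E)" for s
    using eventually_small_radius
    by (intro Liminf_bounded) (auto elim!: eventually_mono simp: content_nonneg)
  show "lower_minkowski_dim E \<le> ?L"
  proof (rule dense_ge)
    fix x assume "?L < x"
    from ereal_dense2[OF this] obtain s where s: "?L < ereal s" "ereal s < x" by blast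
    from ereal_dense2[OF s(1)] obtain t where t: "?L < ereal t" "ereal t < ereal s" by blast
    have "0 < ereal s" using L s(1) by (rule le_less_trans)
    then have s0: "s \<ge> 0" by simp
    have "Liminf (at_right 0) (\<lambda>r. minkowski_content s r E) = 0"
    proof (rule ccontr)
      assume "\<not> ?thesis"
      then have "0 < Liminf (at_right 0) (\<lambda>r. minkowski_content s r E)"
        using nonneg[of s] by (simp add: less_le)
      from ereal_dense2[OF this] obtain e where
        e: "0 < ereal e" "ereal e < Liminf (at_right 0) (\<lambda>r. minkowski_content s r E)" by blast
      have "\<forall>\<^sub>F r in at_right 0. ereal e < minkowski_content s r E" using less_LiminfD[OF e(2)] .
      then have 1: "\<forall>\<^sub>F k in sequentially. ereal e < minkowski_content s ((1/2) ^ k) E"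
        by (rule eventually_compose_filterlim[OF _ filterlim_half_power])
      have "t - s < 0" using t by simp
      then have "((\<lambda>k. 2 powr ((t - s) * real k)) \<longlongrightarrow> 0) sequentially"
        by (rule powr_neg_mult_tendsto_0)
      \<comment> \<open>The decaying power drops below the lower bound \<open>e\<close> of the
        content, so comparing exponents of 2 gives \<open>t < dyadic_exponent k\<close>.\<close>
      then have 2: "\<forall>\<^sub>F k in sequentially. 2 powr ((t - s) * real k) < e"
        using e(1) by (intro order_tendstoD) auto
      have "\<forall>\<^sub>F k in sequentially. ereal t \<le> ereal (dyadic_exponent k)"
        using 1 2 eventually_gt_at_top[of 0]
      proof eventually_elim
        case (elim k)
        then have "e < 2 powr ((dyadic_exponent k - s) * real k)"
          by (simp add: content_dyadic)
        with elim(2) have "2 powr ((t - s) * real k) < 2 powr ((dyadic_exponent k - s) * real k)"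
          by (rule less_trans)
        then have "(t - s) * real k < (dyadic_exponent k - s) * real k"
          by (subst (asm) powr_less_cancel_iff) auto
        then show ?case using elim(3) by simp
      qed
      then have "ereal t \<le> ?L" by (rule Liminf_bounded)
      then show False using t(1) by simp
    qed
    then have "lower_minkowski_dim E \<le> ereal s"
      unfolding lower_minkowski_dim_def using s0 by (intro Inf_lower) blast
    then show "lower_minkowski_dim E \<le> x" using s(2) by simp
  qed
  show "?L \<le> lower_minkowski_dim E"
    unfolding lower_minkowski_dim_def
  proof (rule Inf_greatest, clarify, rule ccontr)
    fix s :: real assume s: "0 \<le> s" "Liminf (at_right 0) (\<lambda>r. minkowski_content s r E) = 0"
      and "\<not> ?L \<le> ereal s"
    then have "\<forall>\<^sub>F k in sequentially. ereal s < ereal (dyadic_exponent k)"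
      by (intro less_LiminfD) simp
    then have "\<forall>\<^sub>F k in sequentially. s < dyadic_exponent k \<and> 0 < k"
      using eventually_gt_at_top[of 0] by eventually_elim simp
    then have "\<forall>\<^sub>F r in at_right 0. s < dyadic_exponent (nat \<lfloor>log 2 (1 / r)\<rfloor>) \<and> 0 < nat \<lfloor>log 2 (1 / r)\<rfloor>"
      by (rule eventually_compose_filterlim[OF _ filterlim_dyadic_scale])
    then have "\<forall>\<^sub>F r in at_right 0. ereal (2 powr (-s)) \<le> minkowski_content s r E"
      using eventually_small_radius
    proof eventually_elim
      case (elim r)
      let ?k = "nat \<lfloor>log 2 (1 / r)\<rfloor>"
      have "2 powr 0 \<le> 2 powr ((dyadic_exponent ?k - s) * real ?k)"
        using elim by (intro powr_mono mult_nonneg_nonneg) auto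
      then have "2 powr (-s) * 1 \<le> 2 powr (-s) * 2 powr ((dyadic_exponent ?k - s) * real ?k)"
        by (intro mult_left_mono) auto
      then have "ereal (2 powr (-s)) \<le> ereal (2 powr (-s) * 2 powr ((dyadic_exponent ?k - s) * real ?k))"
        by simp
      also have "\<dots> \<le> minkowski_content s r E"
        using elim s(1) by (intro content_ge) auto
      finally show ?case .
    qed
    from Liminf_bounded[OF this] show False using s(2) by simp
  qed
qed

text \<open>The private notions are unfolded so that the formulas speak of covering numbers outside
  the context.\<close>

lemmas minkowski_dim_dyadic =
  upper_minkowski_dim_dyadic[unfolded dyadic_exponent_def dyadic_number_def]
  lower_minkowski_dim_dyadic[unfolded dyadic_exponent_def dyadic_number_def]

end

section \<open>Counting Whitney balls\<close>

lemma whitney_level_nat: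
  "whitney_level W (int k) = {(x, r)\<in>W. (1/2) ^ k / 2 < r \<and> r \<le> (1/2) ^ k}"
proof -
  have "(2::real) powi (- int k) = (1/2) ^ k"
    by (simp add: power_int_minus power_one_over inverse_eq_divide)
  moreover have "(2::real) powi (- int k - 1) = (1/2) ^ k / 2"
    by (simp add: power_int_diff power_int_minus power_one_over inverse_eq_divide)
  ultimately show ?thesis unfolding whitney_level_def by (simp only:)
qed

text \<open>A ball of small radius about \<open>z\<close> containing the center of a level \<open>k\<close> Whitney ball has its
  own center \<open>z\<close> in that Whitney ball, so bounded overlap controls how many centers it contains.\<close>

lemma card_whitney_level_le:
  fixes E :: "'a::metric_space set"
  assumes dbl: "\<And>(x::'a) r. r > 0 \<Longrightarrow> \<exists>c::nat \<Rightarrow> 'a. cball x r \<subseteq> (\<Union>k<N. cball (c k) (r / 2))"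
    and E: "compact E" "E \<noteq> {}"
    and W: "\<And>x r. (x, r) \<in> W \<Longrightarrow> r = infdist x E / 8"
    and overlap: "\<And>y. finite {(x, r)\<in>W. y \<in> cball x r} \<and> card {(x, r)\<in>W. y \<in> cball x r} \<le> m"
  shows "finite (whitney_level W (int k)) \<and>
         card (whitney_level W (int k)) \<le> covering_number ((1/2) ^ k) E * N ^ 5 * m"
proof -
  let ?d = "(1/2::real) ^ k"
  have d: "?d > 0" by simp
  obtain F where F: "finite F" "card F = covering_number ?d E" "E \<subseteq> (\<Union>x\<in>F. cball x ?d)"
    using covering_number_attained[OF E(1) d] by metis
  \<comment> \<open>A level \<open>k\<close> center is within \<open>8 * ?d\<close> of
    \<open>E\<close>, hence within \<open>9 * ?d\<close> of \<open>F\<close>. Five halvings give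
    radius \<open>9 / 32 * ?d\<close>, less than \<open>?d / 2\<close> and so less than every level
    \<open>k\<close> radius.\<close>
  obtain G where G: "finite G" "card G \<le> card F * N ^ 5"
    "(\<Union>x\<in>F. cball x (9 * ?d)) \<subseteq> (\<Union>z\<in>G. cball z (9 * ?d / 2 ^ 5))"
    using doubling_cover_union[of N "9 * ?d" F 5, OF dbl _ F(1)] by auto
  let ?A = "\<lambda>z. {(x, r)\<in>W. z \<in> cball x r}"
  have sub: "whitney_level W (int k) \<subseteq> (\<Union>z\<in>G. ?A z)"
  proof clarify
    fix x r assume "(x, r) \<in> whitney_level W (int k)"
    then have xr: "(x, r) \<in> W" "?d / 2 < r" "r \<le> ?d" by (auto simp: whitney_level_nat)
    obtain e where e: "e \<in> E" "\<And>y. y \<in> E \<Longrightarrow> dist x e \<le> dist x y"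
      using continuous_attains_inf[OF E, of "dist x"] continuous_on_dist[OF continuous_on_const continuous_on_id]
      by (metis (no_types, lifting))
    have "dist x e \<le> infdist x E"
      unfolding infdist_notempty[OF E(2)] using E(2) e(2) by (intro cINF_greatest)
    obtain f where f: "f \<in> F" "dist f e \<le> ?d" using F(3) e(1) by fastforce
    have "dist f x \<le> 9 * ?d"
      using dist_triangle[of f x e] f(2) \<open>dist x e \<le> infdist x E\<close> W[OF xr(1)] xr(3) by (simp add: dist_commute)
    then have "x \<in> (\<Union>f\<in>F. cball f (9 * ?d))" using f(1) by auto
    then obtain z where "z \<in> G" "x \<in> cball z (9 * ?d / 2 ^ 5)" using G(3) by blast
    then have "z \<in> G" "dist z x \<le> 9 * ?d / 2 ^ 5" by simp_all
    moreover have "9 * ?d / 2 ^ 5 = 9 / 32 * ?d" by simp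
    then have "9 * ?d / 2 ^ 5 \<le> r" using xr(2) d by linarith
    ultimately have "z \<in> G" "(x, r) \<in> ?A z" using xr(1) by (auto simp: dist_commute)
    then show "(x, r) \<in> (\<Union>z\<in>G. ?A z)" by blast
  qed
  have fin: "finite (\<Union>z\<in>G. ?A z)" using G(1) overlap by blast
  have "card (whitney_level W (int k)) \<le> card (\<Union>z\<in>G. ?A z)" using sub fin by (rule card_mono[rotated])
  also have "\<dots> \<le> (\<Sum>z\<in>G. card (?A z))" using G(1) by (rule card_UN_le)
  also have "\<dots> \<le> card G * m" using sum_bounded_above[of G "\<lambda>z. card (?A z)" m] overlap by simp
  also have "\<dots> \<le> covering_number ?d E * N ^ 5 * m" using G(2) F(2) by simp
  finally show ?thesis using finite_subset[OF sub fin] by blast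
qed

section \<open>Points at a prescribed distance from the set\<close>

lemma curve_length_dist:
  assumes "curve_length \<gamma> \<le> ereal l" "0 \<le> t" "t \<le> 1"
  shows "dist (\<gamma> 0) (\<gamma> t) \<le> l"
proof -
  \<comment> \<open>The partition 0, \<open>t\<close>, 1 suffices: its sum is at most the length and
    at least its first term.\<close>
  define u :: "nat \<Rightarrow> real" where "u i = (if i = 0 then 0 else if i = 1 then t else 1)" for i
  have "ereal (\<Sum>i<2. dist (\<gamma> (u i)) (\<gamma> (u (Suc i)))) \<le> curve_length \<gamma>"
    unfolding curve_length_def
  proof (intro Sup_upper, clarsimp, intro exI conjI)
    show "u 0 = 0" "u 2 = 1" "\<forall>i<2. u i \<le> u (Suc i)"
      using assms by (auto simp: u_def)
  qed simp
  then have "ereal (dist (\<gamma> 0) (\<gamma> t) + dist (\<gamma> t) (\<gamma> 1)) \<le> curve_length \<gamma>"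
    by (simp add: u_def numeral_2_eq_2)
  also note assms(1)
  finally show ?thesis using zero_le_dist[of "\<gamma> t" "\<gamma> 1"] unfolding ereal_less_eq by linarith
qed

text \<open>Along the curve the distance to \<open>E\<close> runs continuously from 0 to
  \<open>infdist y E\<close>, so it takes the value \<open>h\<close>; every point of the curve is
  within the curve's length of \<open>x\<close>.\<close>

lemma quasiconvex_infdist_attained:
  fixes E :: "'a::metric_space set"
  assumes qc: "\<And>x y::'a. \<exists>\<gamma>. path \<gamma> \<and> pathstart \<gamma> = x \<and> pathfinish \<gamma> = y \<and>
      curve_length \<gamma> \<le> ereal (q * dist x y)"
    and "x \<in> E" "0 \<le> h" "h \<le> infdist y E"
  obtains z where "infdist z E = h" "dist x z \<le> q * dist x y"
proof -
  obtain \<gamma> where g: "path \<gamma>" "\<gamma> 0 = x" "\<gamma> 1 = y" "curve_length \<gamma> \<le> ereal (q * dist x y)"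
    using qc[of x y] by (auto simp: pathstart_def pathfinish_def)
  have "continuous_on {0..1} (\<lambda>t. infdist (\<gamma> t) E)"
    using g(1) unfolding path_def by (rule continuous_on_infdist)
  then obtain t where t: "0 \<le> t" "t \<le> 1" "infdist (\<gamma> t) E = h"
    using IVT'[of "\<lambda>t. infdist (\<gamma> t) E" 0 h 1] g(2,3) assms(2,3,4) by auto
  show thesis using that[OF t(3)] curve_length_dist[OF g(4) t(1,2)] g(2) by simp
qed

text \<open>The singleton case is separate because porosity is vacuous when the diameter is zero.\<close>

lemma porous_points_at_distance:
  fixes E :: "'a::metric_space set"
  assumes qc: "\<And>x y::'a. \<exists>\<gamma>. path \<gamma> \<and> pathstart \<gamma> = x \<and> pathfinish \<gamma> = y \<and>
      curve_length \<gamma> \<le> ereal (q * dist x y)"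
    and q: "q \<ge> 1"
    and E: "compact E" "E \<noteq> UNIV" and por: "porous E"
  shows "\<exists>A>0. \<exists>R>0. \<forall>h x. 0 < h \<longrightarrow> h < R \<longrightarrow> x \<in> E \<longrightarrow>
           (\<exists>z. infdist z E = h \<and> dist x z \<le> A * h)"
proof (cases "\<exists>a\<in>E. \<exists>b\<in>E. a \<noteq> b")
  case True
  then obtain a b where ab: "a \<in> E" "b \<in> E" "a \<noteq> b" by blast
  have bdd: "bounded E" using E(1) by (rule compact_imp_bounded)
  have diam: "diameter E > 0"
    using diameter_bounded_bound[OF bdd ab(1,2)] ab(3) by (metis dual_order.strict_trans1 zero_less_dist_iff)
  obtain \<rho> where rho: "0 < \<rho>" "porous_with \<rho> E" using por unfolding porous_def by blast
  show ?thesis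
  proof (rule exI[of _ "q / \<rho>"], intro conjI exI[of _ "\<rho> * diameter E"] allI impI)
    show "q / \<rho> > 0" "\<rho> * diameter E > 0" using q rho diam by auto
    fix h x assume h: "0 < h" "h < \<rho> * diameter E" and x: "x \<in> E"
    \<comment> \<open>Porosity is applied at radius \<open>h / \<rho>\<close>, so that the hole has
      radius exactly \<open>h\<close>. Its center is within \<open>h / \<rho>\<close> of
      \<open>x\<close>, and the curve adds the factor \<open>q\<close>.\<close>
    have "0 < h / \<rho>" "h / \<rho> < diameter E" using h rho by (auto simp: field_simps)
    then obtain y where y: "cball y (\<rho> * (h / \<rho>)) \<subseteq> cball x (h / \<rho>) - E"
      using rho(2) x unfolding porous_with_def by blast
    then have ball: "cball y h \<subseteq> cball x (h / \<rho>) - E" using rho by simp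
    have "h \<le> infdist y E"
    proof -
      have "E \<noteq> {}" using x by blast
      moreover have "h \<le> dist y e" if "e \<in> E" for e using ball that by force
      ultimately show ?thesis unfolding infdist_notempty[OF \<open>E \<noteq> {}\<close>] by (intro cINF_greatest)
    qed
    then obtain z where z: "infdist z E = h" "dist x z \<le> q * dist x y"
      using quasiconvex_infdist_attained[OF qc x] h(1) by (metis less_imp_le)
    have "y \<in> cball y h" using h(1) by simp
    then have "dist x y \<le> h / \<rho>" using ball by fastforce
    then have "q * dist x y \<le> q * (h / \<rho>)" using q by (intro mult_left_mono) auto
    then show "\<exists>z. infdist z E = h \<and> dist x z \<le> q / \<rho> * h" using z by auto
  qed
next
  case False
  obtain y where y: "y \<notin> E" using E(2) by blast
  show ?thesis
  proof (cases "E = {}")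
    case True
    then show ?thesis using zero_less_one by blast
  next
    case ne: False
    then obtain p where p: "E = {p}" using False by blast
    \<comment> \<open>For a single point, distance to \<open>E\<close> is distance to that point, so
      the factor is 1; a curve to \<open>y\<close> attains every distance below
      \<open>dist y p\<close>.\<close>
    show ?thesis
    proof (rule exI[of _ 1], intro conjI exI[of _ "dist y p"] allI impI)
      show "dist y p > 0" using y p by auto
      fix h x assume h: "0 < h" "h < dist y p" and x: "x \<in> E"
      obtain z where "infdist z E = h"
        using quasiconvex_infdist_attained[OF qc x, of h y] h p by (auto simp: less_imp_le)
      then show "\<exists>z. infdist z E = h \<and> dist x z \<le> 1 * h" using x p by (auto simp: dist_commute)
    qed simp
  qed
qed

text \<open>A point at distance exactly \<open>5 \<cdot> 2\<^sup>-\<^sup>k\<close> from \<open>E\<close> lies only in Whitney balls of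
  level \<open>k\<close>: the radius \<open>r\<close> satisfies \<open>7 r \<le> 5 \<cdot> 2\<^sup>-\<^sup>k \<le> 9 r\<close>.\<close>

lemma covering_number_le_card_whitney_level:
  fixes E :: "'a::metric_space set"
  assumes near: "\<And>x. x \<in> E \<Longrightarrow> \<exists>z. infdist z E = 5 * (1/2) ^ k \<and> dist x z \<le> A * (5 * (1/2) ^ k)"
    and W: "\<And>x r. (x, r) \<in> W \<Longrightarrow> r = infdist x E / 8"
    and cover: "UNIV - E \<subseteq> (\<Union>(x, r)\<in>W. cball x r)"
    and fin: "finite (whitney_level W (int k))"
  shows "covering_number (2 * ((5 * A + 1) * (1/2) ^ k)) E \<le> card (whitney_level W (int k))"
proof -
  let ?d = "(1/2::real) ^ k"
  have d: "?d > 0" by simp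
  let ?G = "fst ` whitney_level W (int k)"
  have "E \<subseteq> (\<Union>z\<in>?G. cball z ((5 * A + 1) * ?d))"
  proof
    fix x assume "x \<in> E"
    then obtain z where z: "infdist z E = 5 * ?d" "dist x z \<le> A * (5 * ?d)" using near by blast
    then have "z \<notin> E" using d by (metis infdist_zero less_irrefl mult_pos_pos zero_less_numeral)
    then obtain w r where w: "(w, r) \<in> W" "dist w z \<le> r" using cover by auto
    have "8 * r \<le> 5 * ?d + r" "5 * ?d \<le> 8 * r + r"
      using infdist_triangle[of w E z] infdist_triangle[of z E w] w(2) z(1) W[OF w(1)]
      by (auto simp: dist_commute)
    \<comment> \<open>The constant 5 is chosen so that both 5/9 and 5/7 fall in the level window
      between 1/2 and 1.\<close>
    then have r: "?d / 2 < r" "r \<le> ?d" using d by linarith+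
    then have "(w, r) \<in> whitney_level W (int k)" using w(1) by (simp add: whitney_level_nat)
    \<comment> \<open>The point \<open>z\<close> contributes \<open>5 * A * ?d\<close>, and the
      Whitney radius at most \<open>?d\<close>.\<close>
    moreover have "dist w x \<le> (5 * A + 1) * ?d"
      using dist_triangle[of w x z] w(2) z(2) r(2) by (simp add: dist_commute algebra_simps)
    ultimately show "x \<in> (\<Union>z\<in>?G. cball z ((5 * A + 1) * ?d))" by force
  qed
  then have "covering_number (2 * ((5 * A + 1) * ?d)) E \<le> card ?G"
    using fin by (intro covering_number_le_off_center) auto
  also have "\<dots> \<le> card (whitney_level W (int k))" using fin by (rule card_image_le)
  finally show ?thesis .
qed

text \<open>The upper bound on the number of balls holds at every level; the lower one starts once
  \<open>5 * (1/2) ^ k\<close> is below the scale up to which porosity supplies points.\<close>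

lemma card_whitney_level_comparable:
  fixes E :: "'a::metric_space set"
  assumes "doubling_space TYPE('a)" "quasiconvex_space TYPE('a)"
    and E: "E \<noteq> {}" "compact E" "porous E" "E \<noteq> UNIV"
    and W: "whitney_cover (UNIV - E) W"
  shows "\<exists>c\<ge>1. \<forall>\<^sub>F k in sequentially. finite (whitney_level W (int k)) \<and>
      real (covering_number ((1/2) ^ k) E) \<le> c * real (card (whitney_level W (int k))) \<and>
      real (card (whitney_level W (int k))) \<le> c * real (covering_number ((1/2) ^ k) E)"
proof -
  obtain N where dbl:
    "\<And>(x::'a) r. r > 0 \<Longrightarrow> \<exists>c::nat \<Rightarrow> 'a. cball x r \<subseteq> (\<Union>k<N. cball (c k) (r / 2))"
    using assms(1) unfolding doubling_space_def by blast
  obtain q where q: "q \<ge> 1" and qc: "\<And>x y::'a. \<exists>\<gamma>. path \<gamma> \<and> pathstart \<gamma> = x \<and>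
      pathfinish \<gamma> = y \<and> curve_length \<gamma> \<le> ereal (q * dist x y)"
    using assms(2) unfolding quasiconvex_space_def by blast
  have rad: "r = infdist x E / 8" if "(x, r) \<in> W" for x r
    using W that unfolding whitney_cover_def by (auto simp: Compl_eq_Diff_UNIV double_diff)
  have cover: "UNIV - E = (\<Union>(x, r)\<in>W. cball x r)"
    using W unfolding whitney_cover_def by blast
  obtain C where C: "\<And>y. finite {(x, r)\<in>W. y \<in> cball x r} \<and>
      real (card {(x, r)\<in>W. y \<in> cball x r}) \<le> C"
    using W unfolding whitney_cover_def by blast
  define m where "m = nat \<lceil>C\<rceil>"
  have overlap: "finite {(x, r)\<in>W. y \<in> cball x r} \<and> card {(x, r)\<in>W. y \<in> cball x r} \<le> m" for y
    using C[of y] unfolding m_def by linarith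
  note upper = card_whitney_level_le[OF dbl E(2,1) rad overlap]
  obtain A R where A: "A > 0" "R > 0" and near: "\<And>h x. 0 < h \<Longrightarrow> h < R \<Longrightarrow> x \<in> E \<Longrightarrow>
      \<exists>z. infdist z E = h \<and> dist x z \<le> A * h"
    using porous_points_at_distance[OF qc q E(2,4,3)] by blast
  \<comment> \<open>Whitney centers give a cover of radius
    \<open>2 * (5 * A + 1) * (1/2) ^ k\<close>. This is at most \<open>2 ^ p * (1/2) ^ k\<close>,
    and \<open>covering_number_doubling\<close> then returns to radius
    \<open>(1/2) ^ k\<close>.\<close>
  obtain p where p: "2 * (5 * A + 1) < 2 ^ p" using real_arch_pow[of 2 "2 * (5 * A + 1)"] by auto
  \<comment> \<open>The sum dominates the constants of both bounds; the summand 1 ensures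
    \<open>c \<ge> 1\<close>.\<close>
  define c where "c = real (N ^ 5 * m + N ^ Suc p + 1)"
  have "(\<lambda>k. 5 * (1/2::real) ^ k) \<longlonglongrightarrow> 0" by real_asymp
  then have "\<forall>\<^sub>F k in sequentially. 5 * (1/2::real) ^ k < R"
    using A(2) by (intro order_tendstoD)
  then have "\<forall>\<^sub>F k in sequentially. finite (whitney_level W (int k)) \<and>
      real (covering_number ((1/2) ^ k) E) \<le> c * real (card (whitney_level W (int k))) \<and>
      real (card (whitney_level W (int k))) \<le> c * real (covering_number ((1/2) ^ k) E)"
  proof eventually_elim
    case (elim k)
    let ?d = "(1/2::real) ^ k" and ?w = "card (whitney_level W (int k))"
    have fin: "finite (whitney_level W (int k))" and up: "?w \<le> covering_number ?d E * N ^ 5 * m"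
      using upper[of k] by auto
    have "covering_number ?d E \<le> covering_number (2 ^ p * ?d) E * N ^ Suc p"
      by (rule covering_number_doubling[OF dbl E(2)]) auto
    also have "covering_number (2 ^ p * ?d) E \<le> covering_number (2 * ((5 * A + 1) * ?d)) E"
      using A p by (intro covering_number_antimono E) (auto simp: mult.assoc[symmetric])
    also have "\<dots> \<le> ?w"
      using near elim cover fin rad by (intro covering_number_le_card_whitney_level) auto
    finally have low: "covering_number ?d E \<le> ?w * N ^ Suc p" by simp
    have "covering_number ?d E \<le> (N ^ 5 * m + N ^ Suc p + 1) * ?w"
      using low by (simp add: algebra_simps)
    then have 1: "real (covering_number ?d E) \<le> c * real ?w"
      unfolding c_def of_nat_mult[symmetric] of_nat_le_iff .
    have "?w \<le> (N ^ 5 * m + N ^ Suc p + 1) * covering_number ?d E"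
      using up by (simp add: algebra_simps)
    then have "real ?w \<le> c * real (covering_number ?d E)"
      unfolding c_def of_nat_mult[symmetric] of_nat_le_iff .
    with 1 fin show ?case by blast
  qed
  moreover have "c \<ge> 1" by (simp add: c_def)
  ultimately show ?thesis by blast
qed

section \<open>Constant factors in the limit\<close>

lemma comparable_log_diff_tendsto_0:
  fixes u v :: "nat \<Rightarrow> real"
  assumes "c \<ge> 1" "\<And>k. 1 \<le> u k" "\<forall>\<^sub>F k in sequentially. u k \<le> c * v k \<and> v k \<le> c * u k"
  shows "(\<lambda>k. log 2 (v k) / real k - log 2 (u k) / real k) \<longlonglongrightarrow> 0"
proof (rule Lim_null_comparison)
  \<comment> \<open>Logarithms turn the factor \<open>c\<close> into an additive error of at most
    \<open>log 2 c\<close>, which division by \<open>k\<close> sends to 0. Since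
    \<open>1 \<le> u k\<close>, comparability forces \<open>v k > 0\<close>.\<close>
  show "\<forall>\<^sub>F k in sequentially. norm (log 2 (v k) / real k - log 2 (u k) / real k) \<le> log 2 c / real k"
    using assms(3)
  proof eventually_elim
    case (elim k)
    have u: "u k > 0" using assms(2)[of k] by simp
    then have v: "v k > 0" using elim assms(1) by (smt (verit) mult_le_0_iff)
    have "log 2 (u k) \<le> log 2 (c * v k)" "log 2 (v k) \<le> log 2 (c * u k)"
      using elim u v by auto
    then have "\<bar>log 2 (v k) - log 2 (u k)\<bar> \<le> log 2 c"
      using u v assms(1) by (simp add: log_mult abs_le_iff)
    then show ?case
      by (simp add: diff_divide_distrib[symmetric] divide_right_mono)
  qed
  show "(\<lambda>k. log 2 c / real k) \<longlonglongrightarrow> 0" by real_asymp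
qed

theorem theorem4p1:
  fixes E :: "'a::metric_space set" and W :: "('a \<times> real) set"
  assumes "\<exists>x y :: 'a. x \<noteq> y"
    and "doubling_space TYPE('a)"
    and "quasiconvex_space TYPE('a)"
    and "E \<noteq> {}" and "compact E" and "porous E" and "E \<noteq> UNIV"
    and "whitney_cover (UNIV - E) W"
  shows "upper_minkowski_dim E =
           limsup (\<lambda>k. ereal (1 / real k) * log2_card (whitney_level W (int k))) \<and>
         lower_minkowski_dim E =
           liminf (\<lambda>k. ereal (1 / real k) * log2_card (whitney_level W (int k)))"
proof -
  define u where "u k = real (covering_number ((1/2) ^ k) E)" for k
  define v where "v k = real (card (whitney_level W (int k)))" for k
  define a where "a k = log 2 (u k) / real k" for k
  define b where "b k = log 2 (v k) / real k" for k
  obtain c where c: "c \<ge> 1" and cmp: "\<forall>\<^sub>F k in sequentially.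
      finite (whitney_level W (int k)) \<and> u k \<le> c * v k \<and> v k \<le> c * u k"
    using card_whitney_level_comparable[OF assms(2-8)] unfolding u_def v_def by blast
  have u1: "1 \<le> u k" for k
    unfolding u_def using covering_number_ge_1[OF assms(5,4), of "(1/2)^k"] by simp
  have "(\<lambda>k. b k - a k) \<longlonglongrightarrow> 0"
    unfolding a_def b_def using cmp
    by (intro comparable_log_diff_tendsto_0[OF c u1]) (auto elim: eventually_mono)
  then have lim: "(\<lambda>k. ereal (b k - a k)) \<longlonglongrightarrow> 0"
    unfolding zero_ereal_def by (rule tendsto_ereal)
  \<comment> \<open>Adding a null sequence changes neither the upper nor the lower limit.\<close>
  have "(\<lambda>k. ereal (b k)) = (\<lambda>k. ereal (b k - a k) + ereal (a k))" by auto
  then have eq: "limsup (\<lambda>k. ereal (b k)) = limsup (\<lambda>k. ereal (a k))"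
      "liminf (\<lambda>k. ereal (b k)) = liminf (\<lambda>k. ereal (a k))"
    using ereal_limsup_lim_add[OF lim, of "\<lambda>k. ereal (a k)"]
      ereal_liminf_lim_add[OF lim, of "\<lambda>k. ereal (a k)"] by simp_all
  \<comment> \<open>Comparability makes the levels finite and nonempty for large \<open>k\<close>,
    so the infinite values of \<open>log2_card\<close> do not occur there.\<close>
  have ev: "\<forall>\<^sub>F k in sequentially.
      ereal (1 / real k) * log2_card (whitney_level W (int k)) = ereal (b k)"
    using cmp
  proof eventually_elim
    case (elim k)
    then have "v k > 0" using u1[of k] c by (smt (verit) mult_le_0_iff)
    then have "whitney_level W (int k) \<noteq> {}" by (auto simp: v_def)
    then show ?case using elim by (simp add: log2_card_def b_def v_def)
  qed
  show ?thesis
    unfolding Limsup_eq[OF ev] Liminf_eq[OF ev] eq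
    using minkowski_dim_dyadic[OF assms(5,4)] unfolding a_def u_def by blast
qed

end
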